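(* Let $a,b$ be coprime positive integers with $a>1$, and define $f\colon \mathbb{Z}^+\to\mathbb{Z}^+$ by $f(z)=az+b$. Let $z>1$ be an integer coprime with $a$. Then not all of the numbers $f(z),f^2(z),f^3(z),\dots$ are prime, and the length $\ell(z)$ of the rooted Cunningham chain with root $z$ satisfies $\ell(z)<z$.
   Context: $f^n$ denotes the $n$-fold iterate of $f$. For a positive integer $z$, the rooted Cunningham chain with root $z$ is the list $\{f(z),f^2(z),\dots,f^{\ell(z)}(z)\}$ where all listed elements are prime and $f^{\ell(z)+1}(z)$ is composite; i.e. $\ell(z)\ge 0$ is the number of consecutive terms $f(z),f^2(z),\dots$ that are prime before the first composite term. Note $z$ itself is not part of the list and need not be prime. *)

theory Defs
  imports "HOL-Computational_Algebra.Primes"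
begin

definition composite :: "nat \<Rightarrow> bool" where
  "composite n \<longleftrightarrow> n > 1 \<and> \<not> prime n"

text \<open>Positive integers are modelled inside \<^typ>\<open>nat\<close>. The definite description below is
  meaningful only if some iterate of \<open>f\<close> at \<open>z\<close> is composite and all earlier ones are prime;
  such an \<open>l\<close> is then unique.\<close>

definition chain_length :: "(nat \<Rightarrow> nat) \<Rightarrow> nat \<Rightarrow> nat" where
  "chain_length f z =
     (THE l. (\<forall>i\<in>{1..l}. prime ((f ^^ i) z)) \<and> composite ((f ^^ (l + 1)) z))"

definition rooted_cunningham_chain :: "(nat \<Rightarrow> nat) \<Rightarrow> nat \<Rightarrow> nat list" where
  "rooted_cunningham_chain f z = map (\<lambda>i. (f ^^ i) z) [1..<chain_length f z + 1]"

end

(* Since a is invertible modulo z, the map f is injective modulo z. Among the z + 1 residues of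
   z, f(z), ..., f^z(z) two coincide, and cancelling f shows that f^m(z) is congruent to z,
   i.e. to 0, modulo z for some m with 1 \<le> m \<le> z. As f^m(z) > z > 1, it is composite. *)
theory Submission imports Defs "HOL-Number_Theory.Cong" begin

text \<open>Each application of \<open>f\<close> adds at least 1, since a * x \<ge> x and b \<ge> 1.
  This keeps all iterates positive, where \<open>f\<close> is known to be affine, and makes every
  later iterate differ from \<open>z\<close>.\<close>

lemma funpow_affine_ge:
  fixes a b z :: nat and f :: "nat \<Rightarrow> nat"
  assumes "a > 1" "b > 0" "z > 0" and f: "\<And>x. x > 0 \<Longrightarrow> f x = a * x + b"
  shows "(f ^^ n) z \<ge> z + n"
proof (induction n)
  case (Suc n)
  let ?x = "(f ^^ n) z"
  have "?x > 0" using Suc \<open>z > 0\<close> by linarith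
  then have "(f ^^ Suc n) z = a * ?x + b" using f by simp
  moreover have "1 * ?x \<le> a * ?x" using \<open>a > 1\<close> by (intro mult_right_mono) auto
  ultimately show ?case using Suc \<open>b > 0\<close> by linarith
qed simp

text \<open>Induction on \<open>i\<close> strips the outermost \<open>f\<close> from both sides:
  subtract \<open>b\<close>, then cancel \<open>a\<close>, a unit modulo \<open>k\<close>.\<close>

lemma funpow_affine_cong_cancel:
  fixes a b z k :: nat and f :: "nat \<Rightarrow> nat"
  assumes "coprime a k" and f: "\<And>x. x > 0 \<Longrightarrow> f x = a * x + b"
    and pos: "\<And>n. (f ^^ n) z > 0"
    and "[(f ^^ (i + m)) z = (f ^^ i) z] (mod k)"
  shows "[(f ^^ m) z = z] (mod k)"
  using assms(4)
proof (induction i)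
  case (Suc i)
  have "[a * (f ^^ (i + m)) z + b = a * (f ^^ i) z + b] (mod k)"
    using Suc.prems pos f by simp
  then have "[(f ^^ (i + m)) z = (f ^^ i) z] (mod k)"
    using \<open>coprime a k\<close> by (simp add: cong_add_rcancel_nat cong_mult_lcancel_nat)
  then show ?case by (rule Suc.IH)
qed simp

text \<open>The indices 0, ..., \<open>z\<close> outnumber the residues modulo \<open>z\<close> by
  one; a difference of two distinct indices lies between 1 and \<open>z\<close>.\<close>

lemma funpow_affine_dvd:
  fixes a b z :: nat and f :: "nat \<Rightarrow> nat"
  assumes "a > 1" "b > 0" "z > 0" "coprime a z" and f: "\<And>x. x > 0 \<Longrightarrow> f x = a * x + b"
  obtains m where "1 \<le> m" "m \<le> z" "z dvd (f ^^ m) z"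
proof -
  let ?g = "\<lambda>i. (f ^^ i) z mod z"
  have pos: "(f ^^ n) z > 0" for n
    using funpow_affine_ge[OF assms(1-3) f, of n] \<open>z > 0\<close> by linarith
  have "?g ` {..z} \<subseteq> {..<z}" using \<open>z > 0\<close> by auto
  then have "card (?g ` {..z}) < card {..z}"
    using card_mono[of "{..<z}" "?g ` {..z}"] by simp
  then have "\<not> inj_on ?g {..z}" by (rule pigeonhole)
  then obtain i j where ij: "i < j" "j \<le> z" "?g j = ?g i"
    unfolding inj_on_def by (metis atMost_iff linorder_neqE_nat)
  then have "[(f ^^ (i + (j - i))) z = (f ^^ i) z] (mod z)"
    by (simp add: cong_def)
  then have "[(f ^^ (j - i)) z = z] (mod z)"
    using funpow_affine_cong_cancel[OF \<open>coprime a z\<close> f pos] by blast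
  then have "z dvd (f ^^ (j - i)) z" by (simp add: cong_def dvd_eq_mod_eq_0)
  with ij show thesis by (intro that[of "j - i"]) auto
qed

text \<open>Uniqueness for the definite description: a smaller candidate would need a composite
  value where a prime stands, a larger one a prime where the composite stands.\<close>

lemma chain_length_eqI:
  assumes "\<And>i. 1 \<le> i \<Longrightarrow> i \<le> l \<Longrightarrow> prime ((f ^^ i) z)" and "composite ((f ^^ (l + 1)) z)"
  shows "chain_length f z = l"
  unfolding chain_length_def
proof (rule the_equality)
  show "(\<forall>i\<in>{1..l}. prime ((f ^^ i) z)) \<and> composite ((f ^^ (l + 1)) z)"
    by (intro conjI ballI assms) simp_all
next
  fix k
  assume k: "(\<forall>i\<in>{1..k}. prime ((f ^^ i) z)) \<and> composite ((f ^^ (k + 1)) z)"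
  have "\<not> k < l"
  proof
    assume "k < l"
    then have "prime ((f ^^ (k + 1)) z)" by (intro assms(1)) simp_all
    with k show False unfolding composite_def by blast
  qed
  moreover have "\<not> l < k"
  proof
    assume "l < k"
    then have "l + 1 \<in> {1..k}" by simp
    with k have "prime ((f ^^ (l + 1)) z)" by blast
    with assms(2) show False unfolding composite_def by blast
  qed
  ultimately show "k = l" by simp
qed

theorem theorem1:
  fixes a b z :: nat and f :: "nat \<Rightarrow> nat"
  assumes "a > 1" and "b > 0" and "coprime a b"
    and "\<And>x. x > 0 \<Longrightarrow> f x = a * x + b"
    and "z > 1" and "coprime z a"
  shows "\<not> (\<forall>n\<ge>1. prime ((f ^^ n) z)) \<and> length (rooted_cunningham_chain f z) < z"
proof -
  have ge: "(f ^^ n) z \<ge> z + n" for n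
    by (rule funpow_affine_ge[OF assms(1,2) _ assms(4)]) (use \<open>z > 1\<close> in simp_all)
  have "coprime a z" using assms(6) by (simp add: coprime_commute)
  then obtain m where m: "1 \<le> m" "m \<le> z" "z dvd (f ^^ m) z"
    using funpow_affine_dvd[OF assms(1,2) _ _ assms(4)] \<open>z > 1\<close> by (metis less_trans zero_less_one)
  \<comment> \<open>This makes \<open>z\<close> a proper divisor; otherwise a prime \<open>z\<close>
    would be no obstacle to primality.\<close>
  have "(f ^^ m) z \<noteq> z" using ge[of m] m(1) by linarith
  then have not_prime: "\<not> prime ((f ^^ m) z)"
    using m(3) \<open>z > 1\<close> by (auto simp: prime_nat_iff)
  \<comment> \<open>The shift by one makes the least such \<open>l\<close> the number of primes
    before the first non-prime. Iterate \<open>m\<close> has shifted index \<open>m - 1\<close>,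
    whence the strict bound l < z.\<close>
  define P where "P l \<longleftrightarrow> \<not> prime ((f ^^ (l + 1)) z)" for l
  define l where "l = Least P"
  have "P (m - 1)" using not_prime m(1) by (simp add: P_def)
  then have "P l" and "l \<le> m - 1"
    unfolding l_def by (rule LeastI, rule Least_le)
  moreover have "prime ((f ^^ i) z)" if "1 \<le> i" "i \<le> l" for i
  proof -
    have "\<not> P (i - 1)" using that unfolding l_def by (intro not_less_Least) simp
    then show ?thesis using that unfolding P_def by simp
  qed
  \<comment> \<open>A non-prime is composite only if it exceeds 1; \<open>ge\<close> guarantees
    this.\<close>
  ultimately have "chain_length f z = l"
    using ge[of "l + 1"] \<open>z > 1\<close> by (intro chain_length_eqI) (auto simp: composite_def P_def)
  then have "length (rooted_cunningham_chain f z) = l"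
    by (simp add: rooted_cunningham_chain_def del: upt_Suc)
  then have "length (rooted_cunningham_chain f z) < z"
    using \<open>l \<le> m - 1\<close> m(1,2) by linarith
  with not_prime m(1) show ?thesis by blast
qed

end
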